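(* Let $r>0$ be real, and set $x=k_r^2$, $F=\frac{2}{\pi}K(x)$, $t_1=(1-x+x^2)F^4$ and $t_2=(1+x)\left(1-\frac{x}{2}\right)(1-2x)F^6$. Then the system of equations $$(1+8\alpha_{3r})\,z_3^4=t_1,\qquad (1-20\alpha_{3r}-8\alpha_{3r}^2)\,z_3^6=t_2$$ in the unknowns $(\alpha_{3r},z_3)$ has solutions $(\alpha_{3r},z_3)$, and these can be expressed in radicals of $t_1$ and $t_2$.
   Context: $K(w)=\int_0^{\pi/2}\frac{dt}{\sqrt{1-w\sin^2 t}}$ for $0\le w<1$ is the complete elliptic integral of the first kind as a function of the parameter $w$. For real $r>0$, $m_r\in(0,1)$ is the solution of $K(1-m_r)/K(m_r)=\sqrt r$, and $k_r=\sqrt{m_r}$ (so $x=k_r^2=m_r$). Where the symbols originate: $\alpha_r=\left(\frac{c(q^{2/\sqrt3})}{a(q^{2/\sqrt3})}\right)^3$ with $q=e^{-\pi\sqrt r}$, $a(q)=\sum_{m,n\in\mathbb Z}q^{m^2+mn+n^2}$, $c(q)=\sum_{m,n\in\mathbb Z}q^{(m+1/3)^2+(m+1/3)(n+1/3)+(n+1/3)^2}$, and $z_3={}_2F_1(\frac13,\frac23;1;\alpha_{3r})$. "Expressed in radicals of $t_1$ and $t_2$" means obtained from $t_1$, $t_2$ and rational numbers by finitely many field operations and extractions of $n$-th roots, i.e. lying in a radical extension of $\mathbb{Q}(t_1,t_2)$. *)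

theory Defs
  imports "HOL-Analysis.Analysis"
begin

text \<open>Complete elliptic integral of the first kind, as a function of the parameter
  \<open>w\<close> (not of the modulus, whose square is \<open>w\<close>); meaningful for \<open>0 \<le> w < 1\<close>.\<close>

definition ellK :: "real \<Rightarrow> real" where
  "ellK w = integral {0..pi/2} (\<lambda>t. 1 / sqrt (1 - w * (sin t)\<^sup>2))"

definition singular_parameter :: "real \<Rightarrow> real" where
  "singular_parameter r = (THE m. 0 < m \<and> m < 1 \<and> ellK (1 - m) / ellK m = sqrt r)"

definition singular_modulus :: "real \<Rightarrow> real" where
  "singular_modulus r = sqrt (singular_parameter r)"

text \<open>The numbers expressible in radicals of the elements of \<open>S\<close>. In rule \<open>root\<close>, \<open>y\<close> is an
  arbitrary complex \<open>n\<close>-th root of an expressible number, not only a principal one.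
  Since \<open>inverse 0 = 0\<close>, rule \<open>inverse\<close> needs no side condition.\<close>

inductive_set radical_closure :: "complex set \<Rightarrow> complex set" for S :: "complex set" where
  base: "a \<in> S \<Longrightarrow> a \<in> radical_closure S"
| rat: "of_rat q \<in> radical_closure S"
| add: "a \<in> radical_closure S \<Longrightarrow> b \<in> radical_closure S \<Longrightarrow> a + b \<in> radical_closure S"
| minus: "a \<in> radical_closure S \<Longrightarrow> - a \<in> radical_closure S"
| mult: "a \<in> radical_closure S \<Longrightarrow> b \<in> radical_closure S \<Longrightarrow> a * b \<in> radical_closure S"
| inverse: "a \<in> radical_closure S \<Longrightarrow> inverse a \<in> radical_closure S"
| root: "n > 0 \<Longrightarrow> y ^ n \<in> radical_closure S \<Longrightarrow> y \<in> radical_closure S"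

end

theory Submission
  imports Defs "HOL-Computational_Algebra.Fundamental_Theorem_Algebra"
begin

text \<open>Eliminating \<open>z\<close> leaves the quartic \<open>t1 ^ 3 * (1 - 20 * \<alpha> - 8 * \<alpha>\<^sup>2)\<^sup>2 = t2\<^sup>2 * (1 + 8 * \<alpha>) ^ 3\<close>,
  which is nondegenerate because \<open>t1 > 0\<close>, so Ferrari and Cardano express \<open>\<alpha>\<close> in radicals, and
  then \<open>z\<close> is a fourth root of \<open>t1 / (1 + 8 * \<alpha>)\<close>. A real solution with \<open>0 \<le> \<alpha> \<le> 1\<close> comes
  from the intermediate value theorem and \<open>t2\<^sup>2 \<le> t1 ^ 3\<close>, whose defect is
  \<open>27 / 4 * (x * (1 - x) * F ^ 6)\<^sup>2\<close>. Positivity of \<open>t1\<close> requires the singular parameter to be well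
  defined: \<open>K (1 - m) / K m\<close> decreases continuously from infinity to \<open>0\<close> on the unit interval.\<close>

section \<open>Roots of polynomials of degree at most four in radical closures\<close>

lemma radical_closure_diff:
  assumes "a \<in> radical_closure S" "b \<in> radical_closure S"
  shows "a - b \<in> radical_closure S"
  using radical_closure.add[OF assms(1) radical_closure.minus[OF assms(2)]] by simp

lemma radical_closure_divide:
  assumes "a \<in> radical_closure S" "b \<in> radical_closure S"
  shows "a / b \<in> radical_closure S"
  using radical_closure.mult[OF assms(1) radical_closure.inverse[OF assms(2)]]
  by (simp add: divide_inverse)

lemma radical_closure_numeral: "numeral n \<in> radical_closure S"
  using radical_closure.rat[of "numeral n" S] by simp

lemma radical_closure_one: "1 \<in> radical_closure S"
  using radical_closure.rat[of 1 S] by simp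

lemma radical_closure_power:
  assumes "a \<in> radical_closure S"
  shows "a ^ n \<in> radical_closure S"
  by (induction n) (use assms in \<open>auto intro: radical_closure.mult radical_closure_one\<close>)

lemmas radical_closure_intros =
  radical_closure.add radical_closure.minus radical_closure.mult radical_closure_diff
  radical_closure_divide radical_closure_numeral radical_closure_one radical_closure_power

text \<open>Completing the square. The rule \<open>root\<close> accepts either square root, so no
  sign has to be chosen.\<close>

lemma radical_closure_quadratic:
  assumes "b \<in> radical_closure S" "c \<in> radical_closure S"
    and "y\<^sup>2 + b * y + c = 0"
  shows "y \<in> radical_closure S"
proof -
  have "(y + b / 2)\<^sup>2 = (y\<^sup>2 + b * y + c) + ((b / 2)\<^sup>2 - c)"
    by (simp add: field_simps power2_eq_square)
  then have "(y + b / 2)\<^sup>2 = (b / 2)\<^sup>2 - c"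
    by (simp add: assms(3))
  then have "(y + b / 2)\<^sup>2 \<in> radical_closure S"
    using assms(1,2) by (auto intro!: radical_closure_intros)
  then have "y + b / 2 \<in> radical_closure S"
    by (rule radical_closure.root[rotated]) simp
  then have "(y + b / 2) - b / 2 \<in> radical_closure S"
    using assms(1) by (intro radical_closure_diff radical_closure_divide radical_closure_numeral)
  then show ?thesis by simp
qed

text \<open>Cardano: write \<open>y = w + v\<close> with \<open>w * v = - p / 3\<close>. Then \<open>w ^ 3\<close> and \<open>v ^ 3\<close> are the
  two roots of a quadratic equation.\<close>

lemma radical_closure_depressed_cubic:
  assumes "p \<in> radical_closure S" "q \<in> radical_closure S"
    and "y ^ 3 + p * y + q = 0"
  shows "y \<in> radical_closure S"
proof -
  \<comment> \<open>\<open>s\<close> is a square root of the discriminant of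
    \<open>w\<^sup>2 - y * w - p / 3\<close>, so the Cardano pair is \<open>(y + s) / 2\<close> and
    \<open>(y - s) / 2\<close>.\<close>
  define s where "s = csqrt (y\<^sup>2 + 4 * p / 3)"
  have s: "s\<^sup>2 = y\<^sup>2 + 4 * p / 3"
    by (simp add: s_def)
  have cube: "w \<in> radical_closure S" if "w\<^sup>2 - y * w - p / 3 = 0" for w
  proof -
    define v where "v = y - w"
    have y: "y = w + v" and p: "p = - (3 * (w * v))"
      using that by (simp_all add: v_def field_simps power2_eq_square)
    have "q = - (y ^ 3 + p * y)"
      using assms(3) by (metis add.commute eq_neg_iff_add_eq_0)
    also have "\<dots> = - (w ^ 3 + v ^ 3)"
      unfolding p y by (simp add: algebra_simps power3_eq_cube)
    finally have q: "q = - (w ^ 3 + v ^ 3)" .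
    \<comment> \<open>The sum of the cubes is \<open>- q\<close> and their product is
      \<open>- (p ^ 3 / 27)\<close>, so this quadratic no longer involves \<open>y\<close>.\<close>
    have "(w ^ 3)\<^sup>2 + q * w ^ 3 + - (p ^ 3 / 27) = 0"
      unfolding p q by (simp add: algebra_simps power2_eq_square power3_eq_cube)
    then have "w ^ 3 \<in> radical_closure S"
      by (rule radical_closure_quadratic[rotated 2])
        (use assms(1,2) in \<open>auto intro!: radical_closure_intros\<close>)
    then show ?thesis
      by (rule radical_closure.root[rotated]) simp
  qed
  have "(y + s) / 2 \<in> radical_closure S"
    by (rule cube) (simp add: power_divide power2_sum power2_diff s field_simps, simp add: power2_eq_square)
  moreover have "(y - s) / 2 \<in> radical_closure S"
    by (rule cube) (simp add: power_divide power2_sum power2_diff s field_simps, simp add: power2_eq_square)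
  ultimately have "(y + s) / 2 + (y - s) / 2 \<in> radical_closure S"
    by (rule radical_closure.add)
  then show ?thesis by (simp add: field_simps)
qed

lemma radical_closure_cubic:
  assumes "b \<in> radical_closure S" "c \<in> radical_closure S" "d \<in> radical_closure S"
    and "y ^ 3 + b * y\<^sup>2 + c * y + d = 0"
  shows "y \<in> radical_closure S"
proof -
  have "(y + b / 3) ^ 3 + (c - b\<^sup>2 / 3) * (y + b / 3) + (2 * b ^ 3 / 27 - b * c / 3 + d)
      = y ^ 3 + b * y\<^sup>2 + c * y + d"
    by (simp add: field_simps power2_eq_square power3_eq_cube)
  then have "(y + b / 3) ^ 3 + (c - b\<^sup>2 / 3) * (y + b / 3) + (2 * b ^ 3 / 27 - b * c / 3 + d) = 0"
    by (simp only: assms(4))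
  then have "y + b / 3 \<in> radical_closure S"
    by (rule radical_closure_depressed_cubic[rotated 2])
      (use assms(1-3) in \<open>auto intro!: radical_closure_intros\<close>)
  then have "(y + b / 3) - b / 3 \<in> radical_closure S"
    using assms(1) by (intro radical_closure_diff radical_closure_divide radical_closure_numeral)
  then show ?thesis by simp
qed

lemma complex_cubic_has_root:
  fixes b c d :: complex
  obtains m where "m ^ 3 + b * m\<^sup>2 + c * m + d = 0"
proof -
  have "\<not> constant (poly [:d, c, b, 1:])"
    by (simp add: constant_degree)
  then obtain m where "poly [:d, c, b, 1:] m = 0"
    using fundamental_theorem_of_algebra by blast
  then have "m ^ 3 + b * m\<^sup>2 + c * m + d = 0"
    by (simp add: algebra_simps power2_eq_square power3_eq_cube)
  then show ?thesis by (rule that)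
qed

text \<open>Ferrari: a root \<open>m\<close> of the resolvent cubic makes the quartic a difference of two squares.\<close>

lemma radical_closure_depressed_quartic:
  assumes pqr: "p \<in> radical_closure S" "q \<in> radical_closure S" "r \<in> radical_closure S"
    and y: "y ^ 4 + p * y\<^sup>2 + q * y + r = 0"
  shows "y \<in> radical_closure S"
\<comment> \<open>The biquadratic case is split off because its resolvent has the root 0, while
  Ferrari divides by a square root of \<open>2 * m\<close>.\<close>
proof (cases "q = 0")
  case True
  have "(y\<^sup>2)\<^sup>2 + p * y\<^sup>2 + r = 0"
    using y True by simp
  then have "y\<^sup>2 \<in> radical_closure S"
    by (rule radical_closure_quadratic[OF pqr(1,3)])
  then show ?thesis
    by (rule radical_closure.root[rotated]) simp
next
  case False
  \<comment> \<open>The quartic is \<open>(y\<^sup>2 + p / 2 + m)\<^sup>2\<close> minus \<open>2 * m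
    * y\<^sup>2 - q * y + (m\<^sup>2 + p * m + p\<^sup>2 / 4 - r)\<close>. The cubic says that this
    quadratic in \<open>y\<close> has discriminant 0; it then equals
    \<open>(s * y - k)\<^sup>2\<close>.\<close>
  obtain m where m: "m ^ 3 + p * m\<^sup>2 + (p\<^sup>2 / 4 - r) * m + - (q\<^sup>2 / 8) = 0"
    by (rule complex_cubic_has_root)
  have m_in: "m \<in> radical_closure S"
    by (rule radical_closure_cubic[OF _ _ _ m]) (use pqr in \<open>auto intro!: radical_closure_intros\<close>)
  have "m \<noteq> 0"
    using m False by auto
  define s where "s = csqrt (2 * m)"
  have s: "s\<^sup>2 = 2 * m"
    by (simp add: s_def)
  then have "s \<noteq> 0"
    using \<open>m \<noteq> 0\<close> by auto
  have "s\<^sup>2 \<in> radical_closure S"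
    unfolding s using m_in by (intro radical_closure_intros)
  then have s_in: "s \<in> radical_closure S"
    by (rule radical_closure.root[rotated]) simp
  define k where "k = q / (2 * s)"
  have k: "2 * s * k = q"
    using \<open>s \<noteq> 0\<close> by (simp add: k_def)
  have k_in: "k \<in> radical_closure S"
    unfolding k_def using s_in pqr by (intro radical_closure_intros)
  have "8 * m * k\<^sup>2 = q\<^sup>2"
    by (simp add: k[symmetric] power_mult_distrib s)
  also have "q\<^sup>2 = 8 * (m ^ 3 + p * m\<^sup>2 + (p\<^sup>2 / 4 - r) * m)"
    using m by (simp add: field_simps)
  finally have "8 * m * k\<^sup>2 = 8 * m * (m\<^sup>2 + p * m + p\<^sup>2 / 4 - r)"
    by (simp add: algebra_simps power2_eq_square power3_eq_cube)
  then have k2: "k\<^sup>2 = m\<^sup>2 + p * m + p\<^sup>2 / 4 - r"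
    using \<open>m \<noteq> 0\<close> by simp
  have "(y\<^sup>2 + - s * y + (p / 2 + m + k)) * (y\<^sup>2 + s * y + (p / 2 + m - k))
      = y ^ 4 + p * y\<^sup>2 + 2 * s * k * y + r + (2 * m - s\<^sup>2) * y\<^sup>2
        + (m\<^sup>2 + p * m + p\<^sup>2 / 4 - r - k\<^sup>2)"
    by (simp add: field_simps power2_eq_square power4_eq_xxxx)
  also have "\<dots> = 0"
    using y by (simp add: s k k2)
  finally have "y\<^sup>2 + - s * y + (p / 2 + m + k) = 0 \<or> y\<^sup>2 + s * y + (p / 2 + m - k) = 0"
    by simp
  then show ?thesis
    using radical_closure_quadratic[of "- s" S "p / 2 + m + k" y]
      radical_closure_quadratic[of s S "p / 2 + m - k" y] s_in m_in k_in pqr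
    by (auto intro!: radical_closure_intros)
qed

lemma radical_closure_quartic:
  assumes abcde: "a \<in> radical_closure S" "b \<in> radical_closure S" "c \<in> radical_closure S"
      "d \<in> radical_closure S" "e \<in> radical_closure S"
    and "a \<noteq> 0"
    and y: "a * y ^ 4 + b * y ^ 3 + c * y\<^sup>2 + d * y + e = 0"
  shows "y \<in> radical_closure S"
proof -
  \<comment> \<open>After division by \<open>a\<close>, the shift by \<open>h\<close> removes the
    cubic term.\<close>
  define h where "h = b / (4 * a)"
  define C D E where "C = c / a" and "D = d / a" and "E = e / a"
  have coeffs: "b = 4 * a * h" "c = a * C" "d = a * D" "e = a * E"
    using \<open>a \<noteq> 0\<close> by (simp_all add: h_def C_def D_def E_def)
  have "a * (y ^ 4 + 4 * h * y ^ 3 + C * y\<^sup>2 + D * y + E) = 0"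
    using y unfolding coeffs by (simp add: algebra_simps)
  then have "y ^ 4 + 4 * h * y ^ 3 + C * y\<^sup>2 + D * y + E = 0"
    using \<open>a \<noteq> 0\<close> by simp
  moreover have "(y + h) ^ 4 + (C - 6 * h\<^sup>2) * (y + h)\<^sup>2 + (D - 2 * h * C + 8 * h ^ 3) * (y + h)
      + (E - h * D + h\<^sup>2 * C - 3 * h ^ 4) = y ^ 4 + 4 * h * y ^ 3 + C * y\<^sup>2 + D * y + E"
    by (simp add: algebra_simps power2_eq_square power3_eq_cube power4_eq_xxxx)
  ultimately have depressed: "(y + h) ^ 4 + (C - 6 * h\<^sup>2) * (y + h)\<^sup>2
      + (D - 2 * h * C + 8 * h ^ 3) * (y + h) + (E - h * D + h\<^sup>2 * C - 3 * h ^ 4) = 0"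
    by simp
  have in_closure: "h \<in> radical_closure S" "C \<in> radical_closure S" "D \<in> radical_closure S"
      "E \<in> radical_closure S"
    unfolding h_def C_def D_def E_def using abcde by (auto intro!: radical_closure_intros)
  have "y + h \<in> radical_closure S"
    by (rule radical_closure_depressed_quartic[OF _ _ _ depressed])
      (use in_closure in \<open>auto intro!: radical_closure_intros\<close>)
  then have "(y + h) - h \<in> radical_closure S"
    using in_closure(1) by (rule radical_closure_diff)
  then show ?thesis by simp
qed

section \<open>The singular parameter\<close>

lemma one_minus_mult_sin_squared_pos:
  fixes w t :: real
  assumes "w < 1"
  shows "0 < 1 - w * (sin t)\<^sup>2"
proof -
  have "(sin t)\<^sup>2 \<le> 1"
    by (simp add: abs_square_le_1)
  show ?thesis
  proof (cases "w \<le> 0")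
    case True
    then have "w * (sin t)\<^sup>2 \<le> 0"
      by (simp add: mult_nonpos_nonneg)
    then show ?thesis by simp
  next
    case False
    then have "w * (sin t)\<^sup>2 \<le> w * 1"
      using \<open>(sin t)\<^sup>2 \<le> 1\<close> by (intro mult_left_mono) auto
    then show ?thesis using assms by simp
  qed
qed

lemma continuous_on_ellK_integrand:
  assumes "w < 1"
  shows "continuous_on A (\<lambda>t. 1 / sqrt (1 - w * (sin t)\<^sup>2))"
proof -
  have "sqrt (1 - w * (sin t)\<^sup>2) \<noteq> 0" for t
    using one_minus_mult_sin_squared_pos[OF assms, of t] by auto
  then show ?thesis
    by (intro continuous_intros ballI)
qed

lemma continuous_on_ellK: "continuous_on {..<1} ellK"
proof -
  have nz: "sqrt (1 - w * (sin t)\<^sup>2) \<noteq> 0" if "w < 1" for w t :: real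
    using one_minus_mult_sin_squared_pos[OF that, of t] by auto
  \<comment> \<open>Joint continuity over a compact range of \<open>t\<close> carries over to the
    parameter integral.\<close>
  have "continuous_on ({..<1} \<times> cbox 0 (pi/2))
      (\<lambda>(w, t). 1 / sqrt (1 - w * (sin t)\<^sup>2) :: real)"
    unfolding case_prod_unfold by (intro continuous_intros) (use nz in auto)
  then have "continuous_on {..<1} (\<lambda>w. integral (cbox 0 (pi/2)) (\<lambda>t. 1 / sqrt (1 - w * (sin t)\<^sup>2)))"
    by (rule integral_continuous_on_param)
  then show ?thesis
    by (simp add: ellK_def[abs_def])
qed

lemma ellK_strict_mono:
  assumes "v < w" "w < 1"
  shows "ellK v < ellK w"
  unfolding ellK_def
proof (rule integral_less_real)
  \<comment> \<open>Strict comparison holds only in the interior: at \<open>t = 0\<close> the two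
    integrands agree.\<close>
  show "{0<..<pi/2} \<noteq> {}"
    using pi_half_gt_zero by (simp only: greaterThanLessThan_empty_iff not_le)
  fix t :: real assume "t \<in> {0<..<pi/2}"
  then have "0 < sin t"
    by (intro sin_gt_zero) auto
  then have "v * (sin t)\<^sup>2 < w * (sin t)\<^sup>2"
    using assms by (intro mult_strict_right_mono) auto
  then show "1 / sqrt (1 - v * (sin t)\<^sup>2) < 1 / sqrt (1 - w * (sin t)\<^sup>2)"
    using one_minus_mult_sin_squared_pos[OF assms(2), of t] by (intro divide_strict_left_mono) auto
qed (use assms in \<open>auto intro!: continuous_on_ellK_integrand\<close>)

lemma ellK_0: "ellK 0 = pi / 2"
  by (simp add: ellK_def)

lemma ellK_pos:
  assumes "0 \<le> w" "w < 1"
  shows "0 < ellK w"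
proof (cases "w = 0")
  case False
  then have "ellK 0 < ellK w"
    using assms by (intro ellK_strict_mono) auto
  then show ?thesis
    unfolding ellK_0 using pi_gt_zero by linarith
qed (simp add: ellK_0)

text \<open>Since \<open>cos t \<le> pi / 2 - t\<close>, the integrand is at least \<open>1 / (pi / 2 - t + \<epsilon>)\<close>.\<close>

lemma ellK_ge_log:
  assumes "0 < \<epsilon>" "\<epsilon> < 1"
  shows "ln ((pi / 2 + \<epsilon>) / \<epsilon>) \<le> ellK (1 - \<epsilon>\<^sup>2)"
proof -
  have w: "1 - \<epsilon>\<^sup>2 < 1"
    using assms by simp
  have "((\<lambda>t. 1 / (pi / 2 - t + \<epsilon>)) has_integral
      (- ln (pi / 2 - pi / 2 + \<epsilon>) - (- ln (pi / 2 - 0 + \<epsilon>)))) {0..pi/2}"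
    using assms
    by (intro fundamental_theorem_of_calculus)
      (auto intro!: derivative_eq_intros simp flip: has_real_derivative_iff_has_vector_derivative)
  moreover have "((\<lambda>t. 1 / sqrt (1 - (1 - \<epsilon>\<^sup>2) * (sin t)\<^sup>2)) has_integral ellK (1 - \<epsilon>\<^sup>2)) {0..pi/2}"
    unfolding ellK_def
    using integrable_continuous_real[OF continuous_on_ellK_integrand[OF w]]
    by (simp add: has_integral_integral)
  ultimately have "- ln (pi / 2 - pi / 2 + \<epsilon>) - (- ln (pi / 2 - 0 + \<epsilon>)) \<le> ellK (1 - \<epsilon>\<^sup>2)"
  proof (rule has_integral_le)
    fix t assume t: "t \<in> {0..pi/2}"
    have "0 \<le> cos t"
      using t by (intro cos_ge_zero) auto
    moreover have "cos t \<le> pi / 2 - t"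
      using sin_x_le_x[of "pi / 2 - t"] t by (simp add: sin_cos_eq[symmetric] cos_sin_eq)
    ultimately have "(cos t)\<^sup>2 \<le> (pi / 2 - t)\<^sup>2"
      by (intro power_mono)
    moreover have "\<epsilon>\<^sup>2 * (sin t)\<^sup>2 \<le> \<epsilon>\<^sup>2 * 1"
      by (intro mult_left_mono) (auto simp: abs_square_le_1)
    moreover have "0 \<le> 2 * (pi / 2 - t) * \<epsilon>"
      using t assms by auto
    moreover have "1 - (1 - \<epsilon>\<^sup>2) * (sin t)\<^sup>2 = (cos t)\<^sup>2 + \<epsilon>\<^sup>2 * (sin t)\<^sup>2"
      by (simp add: cos_squared_eq algebra_simps)
    ultimately have "1 - (1 - \<epsilon>\<^sup>2) * (sin t)\<^sup>2 \<le> (pi / 2 - t + \<epsilon>)\<^sup>2"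
      unfolding power2_sum[of "pi / 2 - t" \<epsilon>] by linarith
    then have "sqrt (1 - (1 - \<epsilon>\<^sup>2) * (sin t)\<^sup>2) \<le> pi / 2 - t + \<epsilon>"
      using t assms by (intro real_le_lsqrt) auto
    then show "1 / (pi / 2 - t + \<epsilon>) \<le> 1 / sqrt (1 - (1 - \<epsilon>\<^sup>2) * (sin t)\<^sup>2)"
      using one_minus_mult_sin_squared_pos[OF w, of t] t assms
      by (intro divide_left_mono mult_pos_pos) auto
  qed
  moreover have "ln ((pi / 2 + \<epsilon>) / \<epsilon>) = ln (pi / 2 + \<epsilon>) - ln \<epsilon>"
    using assms pi_gt3 by (intro ln_divide_pos) auto
  ultimately show ?thesis by simp
qed

lemma ellK_unbounded:
  obtains m where "1 / 2 < m" "m < 1" "B < ellK m"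
proof -
  \<comment> \<open>The exponential gives \<open>- ln \<epsilon> \<ge> B\<close>, and the positive
    term \<open>ln (pi / 2 + \<epsilon>)\<close> makes the bound strict. The cap 1/2 keeps
    \<open>1 - \<epsilon>\<^sup>2\<close> above 1/2.\<close>
  define \<epsilon> where "\<epsilon> = min (1 / 2) (exp (- B))"
  have \<epsilon>: "0 < \<epsilon>" "\<epsilon> \<le> 1 / 2" "\<epsilon> \<le> exp (- B)"
    by (auto simp: \<epsilon>_def)
  have "ln \<epsilon> \<le> - B"
    using \<epsilon> by (metis ln_exp ln_le_cancel_iff exp_gt_zero)
  moreover have "0 < ln (pi / 2 + \<epsilon>)"
    using \<epsilon> pi_gt3 by (intro ln_gt_zero) auto
  moreover have "ln ((pi / 2 + \<epsilon>) / \<epsilon>) = ln (pi / 2 + \<epsilon>) - ln \<epsilon>"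
    using \<epsilon> pi_gt3 by (intro ln_divide_pos) auto
  ultimately have "B < ellK (1 - \<epsilon>\<^sup>2)"
    using ellK_ge_log[of \<epsilon>] \<epsilon> by linarith
  moreover have "\<epsilon>\<^sup>2 < 1 / 2"
    using power_mono[of \<epsilon> "1 / 2" 2] \<epsilon> by (simp add: power2_eq_square)
  ultimately show ?thesis
    using that[of "1 - \<epsilon>\<^sup>2"] \<epsilon> by simp
qed

lemma ex1_singular_parameter:
  assumes "0 < s"
  shows "\<exists>!m. 0 < m \<and> m < 1 \<and> ellK (1 - m) / ellK m = s"
proof (rule ex_ex1I)
  \<comment> \<open>By monotonicity of \<open>ellK\<close>, the quotient is at least
    \<open>s\<close> at \<open>1 - a\<close> and at most \<open>s\<close> at \<open>b\<close>. Both
    \<open>a\<close> and \<open>b\<close> exceed 1/2, so \<open>1 - a < b\<close>.\<close>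
  obtain a where a: "1 / 2 < a" "a < 1" "s * ellK (1 / 2) < ellK a"
    by (rule ellK_unbounded)
  obtain b where b: "1 / 2 < b" "b < 1" "ellK (1 / 2) / s < ellK b"
    by (rule ellK_unbounded)
  have "s * ellK (1 - a) \<le> s * ellK (1 / 2)"
    using ellK_strict_mono[of "1 - a" "1 / 2"] a assms by simp
  then have "s \<le> ellK (1 - (1 - a)) / ellK (1 - a)"
    using a ellK_pos[of "1 - a"] by (simp add: field_simps)
  moreover have "ellK (1 - b) \<le> s * ellK b"
    using ellK_strict_mono[of "1 - b" "1 / 2"] b assms by (simp add: field_simps)
  then have "ellK (1 - b) / ellK b \<le> s"
    using b ellK_pos[of b] by (simp add: field_simps)
  moreover have "continuous_on {1 - a..b} (\<lambda>m. ellK (1 - m) / ellK m)"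
  proof (intro continuous_on_divide ballI)
    show "continuous_on {1 - a..b} (\<lambda>m. ellK (1 - m))"
      using a by (intro continuous_on_compose2[OF continuous_on_ellK] continuous_intros) auto
    show "continuous_on {1 - a..b} ellK"
      using b by (intro continuous_on_subset[OF continuous_on_ellK]) auto
    show "ellK m \<noteq> 0" if "m \<in> {1 - a..b}" for m
      using ellK_pos[of m] that a b by auto
  qed
  ultimately obtain m where "1 - a \<le> m" "m \<le> b" "ellK (1 - m) / ellK m = s"
    using IVT2'[of "\<lambda>m. ellK (1 - m) / ellK m" b s "1 - a"] a b by auto
  then show "\<exists>m. 0 < m \<and> m < 1 \<and> ellK (1 - m) / ellK m = s"
    using a b by (intro exI[of _ m]) simp
next
  \<comment> \<open>As the parameter grows, the numerator falls and the denominator rises.\<close>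
  have decreasing: "ellK (1 - n) / ellK n < ellK (1 - m) / ellK m" if "0 < m" "m < n" "n < 1" for m n
  proof (rule frac_less)
    show "0 \<le> ellK (1 - n)"
      using that ellK_pos[of "1 - n"] by simp
    show "ellK (1 - n) < ellK (1 - m)"
      using that by (intro ellK_strict_mono) auto
    show "0 < ellK m"
      using that by (intro ellK_pos) auto
    show "ellK m \<le> ellK n"
      using that ellK_strict_mono[of m n] by simp
  qed
  fix m n
  assume "0 < m \<and> m < 1 \<and> ellK (1 - m) / ellK m = s"
    and "0 < n \<and> n < 1 \<and> ellK (1 - n) / ellK n = s"
  then show "m = n"
    using decreasing[of m n] decreasing[of n m] by (cases m n rule: linorder_cases) auto
qed

lemma singular_parameter_bounds:
  assumes "0 < r"
  shows "0 < singular_parameter r" "singular_parameter r < 1"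
  using theI'[OF ex1_singular_parameter[of "sqrt r"]] assms
  unfolding singular_parameter_def by auto

section \<open>The system of equations\<close>

text \<open>A polynomial identity in \<open>x\<close>, multiplied by the common factor
  \<open>F ^ 12\<close>, exhibits the difference as a positive multiple of a square. It is the
  analogue of the Eisenstein series relation E4^3 - E6^2 = 1728 Delta.\<close>

lemma t2_squared_le_t1_cubed:
  fixes x F :: real
  shows "((1 + x) * (1 - x / 2) * (1 - 2 * x) * F ^ 6)\<^sup>2 \<le> ((1 - x + x\<^sup>2) * F ^ 4) ^ 3"
proof -
  have "(1 - x + x\<^sup>2) ^ 3 - ((1 + x) * (1 - x / 2) * (1 - 2 * x))\<^sup>2 = 27 / 4 * (x * (1 - x))\<^sup>2"
    by (simp add: field_simps power2_eq_square power3_eq_cube)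
  then have "((1 - x + x\<^sup>2) ^ 3 - ((1 + x) * (1 - x / 2) * (1 - 2 * x))\<^sup>2) * F ^ 12
      = 27 / 4 * (x * (1 - x))\<^sup>2 * F ^ 12"
    by (rule arg_cong)
  then have "((1 - x + x\<^sup>2) * F ^ 4) ^ 3 - ((1 + x) * (1 - x / 2) * (1 - 2 * x) * F ^ 6)\<^sup>2
      = 27 / 4 * (x * (1 - x) * F ^ 6)\<^sup>2"
    by (simp add: power_mult_distrib left_diff_distrib flip: power_mult)
  moreover have "0 \<le> 27 / 4 * (x * (1 - x) * F ^ 6)\<^sup>2"
    by simp
  ultimately show ?thesis by linarith
qed

lemma system_has_real_solution:
  fixes t1 t2 :: real
  assumes "0 < t1" "t2\<^sup>2 \<le> t1 ^ 3"
  shows "\<exists>\<alpha> z. (1 + 8 * \<alpha>) * z ^ 4 = t1 \<and> (1 - 20 * \<alpha> - 8 * \<alpha>\<^sup>2) * z ^ 6 = t2"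
proof -
  have "\<bar>t2\<bar> \<le> sqrt t1 ^ 3"
    using real_sqrt_le_mono[OF assms(2)] by (simp add: real_sqrt_power[symmetric])
  \<comment> \<open>\<open>f\<close> is the left side of the second equation once the first has
    fixed \<open>z ^ 4\<close>. On the unit interval the quadratic runs from 1 to -27 and
    \<open>sqrt (1 + 8 * \<alpha>) ^ 3\<close> from 1 to 27, so the end values of \<open>f\<close>
    are exactly \<open>sqrt t1 ^ 3\<close> and its negative.\<close>
  define f where "f \<alpha> = (1 - 20 * \<alpha> - 8 * \<alpha>\<^sup>2) * sqrt (t1 / (1 + 8 * \<alpha>)) ^ 3" for \<alpha>
  have "sqrt 9 = (3::real)"
    by (rule real_sqrt_unique) auto
  then have "f 1 = - (sqrt t1 ^ 3)"
    by (simp add: f_def real_sqrt_divide power_divide)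
  moreover have "f 0 = sqrt t1 ^ 3"
    by (simp add: f_def)
  moreover have "continuous_on {0..1} f"
    unfolding f_def by (intro continuous_intros) auto
  ultimately obtain \<alpha> where \<alpha>: "0 \<le> \<alpha>" "f \<alpha> = t2"
    using IVT2'[of f 1 t2 0] \<open>\<bar>t2\<bar> \<le> sqrt t1 ^ 3\<close> by (auto simp: abs_le_iff)
  define u where "u = t1 / (1 + 8 * \<alpha>)"
  define z where "z = sqrt (sqrt u)"
  have "0 \<le> u"
    using \<alpha> assms by (simp add: u_def)
  then have z2: "z\<^sup>2 = sqrt u"
    by (simp add: z_def)
  have "z ^ 4 = (z\<^sup>2)\<^sup>2" "z ^ 6 = (z\<^sup>2) ^ 3"
    by (simp_all flip: power_mult)
  then have "z ^ 4 = u" "z ^ 6 = sqrt u ^ 3"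
    using \<open>0 \<le> u\<close> by (simp_all add: z2)
  then have "(1 + 8 * \<alpha>) * z ^ 4 = t1" "(1 - 20 * \<alpha> - 8 * \<alpha>\<^sup>2) * z ^ 6 = t2"
    using \<alpha> by (simp_all add: u_def f_def)
  then show ?thesis by blast
qed

lemma system_solution_in_radical_closure:
  fixes t1 t2 \<alpha> z :: complex
  assumes "t1 \<noteq> 0"
    and eqs: "(1 + 8 * \<alpha>) * z ^ 4 = t1" "(1 - 20 * \<alpha> - 8 * \<alpha>\<^sup>2) * z ^ 6 = t2"
  shows "\<alpha> \<in> radical_closure {t1, t2}" "z \<in> radical_closure {t1, t2}"
proof -
  have t: "t1 \<in> radical_closure {t1, t2}" "t2 \<in> radical_closure {t1, t2}"
    by (auto intro: radical_closure.base)
  \<comment> \<open>Cubing the first equation and squaring the second both produce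
    \<open>z ^ 12\<close>. Only the left side has degree 4 in \<open>\<alpha>\<close>, whence the
    leading coefficient \<open>64 * t1 ^ 3\<close>.\<close>
  have "t1 ^ 3 * (1 - 20 * \<alpha> - 8 * \<alpha>\<^sup>2)\<^sup>2 = t2\<^sup>2 * (1 + 8 * \<alpha>) ^ 3"
    unfolding eqs[symmetric] by (simp add: power_mult_distrib flip: power_mult)
  moreover have "(64 * t1 ^ 3) * \<alpha> ^ 4 + (320 * t1 ^ 3 - 512 * t2\<^sup>2) * \<alpha> ^ 3
      + (384 * t1 ^ 3 - 192 * t2\<^sup>2) * \<alpha>\<^sup>2 + (- (40 * t1 ^ 3) - 24 * t2\<^sup>2) * \<alpha>
      + (t1 ^ 3 - t2\<^sup>2) = t1 ^ 3 * (1 - 20 * \<alpha> - 8 * \<alpha>\<^sup>2)\<^sup>2 - t2\<^sup>2 * (1 + 8 * \<alpha>) ^ 3"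
    by (simp add: algebra_simps power2_eq_square power3_eq_cube power4_eq_xxxx)
  ultimately have quartic: "(64 * t1 ^ 3) * \<alpha> ^ 4 + (320 * t1 ^ 3 - 512 * t2\<^sup>2) * \<alpha> ^ 3
      + (384 * t1 ^ 3 - 192 * t2\<^sup>2) * \<alpha>\<^sup>2 + (- (40 * t1 ^ 3) - 24 * t2\<^sup>2) * \<alpha>
      + (t1 ^ 3 - t2\<^sup>2) = 0"
    by simp
  show \<alpha>: "\<alpha> \<in> radical_closure {t1, t2}"
    by (rule radical_closure_quartic[OF _ _ _ _ _ _ quartic])
      (use t \<open>t1 \<noteq> 0\<close> in \<open>auto intro!: radical_closure_intros\<close>)
  \<comment> \<open>Otherwise the first equation would give \<open>t1 = 0\<close>.\<close>
  have "1 + 8 * \<alpha> \<noteq> 0"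
    using assms by auto
  then have "z ^ 4 = t1 / (1 + 8 * \<alpha>)"
    using eqs(1) by (simp add: field_simps)
  also have "\<dots> \<in> radical_closure {t1, t2}"
    using t \<alpha> by (intro radical_closure_intros)
  finally show "z \<in> radical_closure {t1, t2}"
    by (rule radical_closure.root[rotated]) simp
qed

theorem theorem2:
  fixes r x F t1 t2 :: real
  assumes "r > 0"
    and "x = (singular_modulus r)\<^sup>2"
    and "F = 2 / pi * ellK x"
    and "t1 = (1 - x + x\<^sup>2) * F ^ 4"
    and "t2 = (1 + x) * (1 - x / 2) * (1 - 2 * x) * F ^ 6"
  shows "(\<exists>(\<alpha>::real) (z::real).
            (1 + 8 * \<alpha>) * z ^ 4 = t1 \<and> (1 - 20 * \<alpha> - 8 * \<alpha>\<^sup>2) * z ^ 6 = t2) \<and>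
         (\<forall>(\<alpha>::complex) (z::complex).
            (1 + 8 * \<alpha>) * z ^ 4 = complex_of_real t1 \<and>
            (1 - 20 * \<alpha> - 8 * \<alpha>\<^sup>2) * z ^ 6 = complex_of_real t2 \<longrightarrow>
            \<alpha> \<in> radical_closure {complex_of_real t1, complex_of_real t2} \<and>
            z \<in> radical_closure {complex_of_real t1, complex_of_real t2})"
proof -
  have x: "0 < x" "x < 1"
    using singular_parameter_bounds[OF assms(1)] assms(2) by (simp_all add: singular_modulus_def)
  then have "0 < F"
    using ellK_pos[of x] assms(3) by simp
  have "0 < 1 - x + x\<^sup>2"
    using x by (simp add: add_pos_pos)
  then have t1: "0 < t1"
    using \<open>0 < F\<close> assms(4) by simp
  have "t2\<^sup>2 \<le> t1 ^ 3"
    unfolding assms(4,5) by (rule t2_squared_le_t1_cubed)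
  then have "\<exists>(\<alpha>::real) z. (1 + 8 * \<alpha>) * z ^ 4 = t1 \<and> (1 - 20 * \<alpha> - 8 * \<alpha>\<^sup>2) * z ^ 6 = t2"
    by (rule system_has_real_solution[OF t1])
  moreover have "complex_of_real t1 \<noteq> 0"
    using t1 by simp
  ultimately show ?thesis
    using system_solution_in_radical_closure by blast
qed

end
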